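(* Let $\{X, X_n, n\ge 1\}$ be a sequence of independent and identically distributed real random variables, let $S_n = X_1+\cdots+X_n$ for $n\ge 1$, and write $\mu = E[X]$ (which is finite under either hypothesis below). (1) If $E[X^2]<\infty$ and it is not the case that $X=\mu$ almost surely, then for every $0<p\le 2$ the sequence $\frac{S_n}{n}$ does not S-$L^p$ converge to $\mu$. (2) If $\alpha>2$ and $E[|X|^{\alpha}]<\infty$, then for every $2<p\le\alpha$ the sequence $\frac{S_n}{n}$ S-$L^p$ converges to $\mu$.
   Context: For $p>0$ and random variables $Y, Y_n$ ($n\ge1$) on a common probability space, $\{Y_n\}$ is said to S-$L^p$ converge to $Y$ if $\sum_{n=1}^{\infty}E[|Y_n-Y|^p]<\infty$. *)

theory Defs
  imports "HOL-Probability.Probability"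
begin

text \<open>
  The sequence is indexed from 1, so the value of \<open>Y\<close> at index 0 is irrelevant. Expectations of the
  nonnegative variables \<open>\<bar>Y n - Z\<bar> powr p\<close> are taken in \<open>[0,\<infinity>]\<close>: the Bochner integral would
  assign 0 to a non-integrable variable, and \<open>suminf\<close> on the reals is meaningless for a divergent
  series.
\<close>

definition S_Lp_converges ::
    "'a measure \<Rightarrow> real \<Rightarrow> (nat \<Rightarrow> 'a \<Rightarrow> real) \<Rightarrow> ('a \<Rightarrow> real) \<Rightarrow> bool" where
  "S_Lp_converges M p Y Z \<longleftrightarrow>
     (\<Sum>n. \<integral>\<^sup>+ \<omega>. ennreal (\<bar>Y (Suc n) \<omega> - Z \<omega>\<bar> powr p) \<partial>M) < \<infinity>"

end

theory Submission
  imports Defs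
begin

text \<open>
  The error \<open>S\<^sub>n / n - \<mu>\<close> has size about \<open>n powr (-1/2)\<close>, so its \<open>p\<close>-th absolute
  moment has order \<open>n powr (-p/2)\<close>, and the series over \<open>n\<close> of these powers converges exactly
  when \<open>p > 2\<close>. The proof makes each half of this heuristic rigorous for the centred partial sums
  \<open>T\<^sub>n = Y\<^sub>1 + \<dots> + Y\<^sub>n\<close>, where \<open>Y\<^sub>i = X\<^sub>i - \<mu>\<close>.

  For \<open>p \<le> 2\<close> a lower bound of this order is needed (\<open>mean_error_eventually_ge\<close>). By the central
  limit theorem, \<open>T\<^sub>n \<le> - \<sigma> * sqrt n\<close> holds with probability tending to the positive
  number \<open>\<Phi>(-1)\<close>, where \<open>\<Phi>\<close> is the standard normal distribution function; on this event
  \<open>\<bar>T\<^sub>n / n\<bar> powr p \<ge> \<sigma> powr p * n powr (-p/2)\<close>.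

  For \<open>p > 2\<close> an upper bound \<open>E \<bar>T\<^sub>n\<bar> powr p \<le> K * n powr (p/2)\<close> is needed, which is a
  bound of Marcinkiewicz--Zygmund type
  (\<open>moment_partial_sum_le\<close>). It has an elementary proof by induction on \<open>n\<close>. A second-order
  expansion of \<open>\<bar>x + y\<bar> powr p\<close> around \<open>x\<close> (\<open>abs_add_powr_le\<close>) has a linear term that vanishes in
  expectation by independence and centring, so
  \<open>E \<bar>T\<^sub>n\<^sub>+\<^sub>1\<bar> powr p \<le> E \<bar>T\<^sub>n\<bar> powr p + C * (E \<bar>T\<^sub>n\<bar> powr (p-2) * E Y\<^sup>2 + E \<bar>Y\<bar> powr p)\<close>.
  By the induction hypothesis the increment has at most the order \<open>n powr (p/2 - 1)\<close>, which is the order of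
  the increment of \<open>n powr (p/2)\<close>; truncation at a suitable level makes the constants match.
\<close>

section \<open>A second-order bound for powers of a sum\<close>

lemma powr_tangent_le:
  fixes a b q :: real
  assumes "a > 0" "b > 0" "q \<ge> 1"
  shows "b powr q \<ge> a powr q + q * a powr (q - 1) * (b - a)"
proof -
  have "b powr q - a powr q \<ge> (q * a powr (q - 1)) * (b - a)"
  proof (rule convex_on_imp_above_tangent[of "{0<..}"])
    show "convex_on {0<..} (\<lambda>x::real. x powr q)"
      by (rule powr_convex[OF assms(3)])
    show "((\<lambda>x. x powr q) has_real_derivative q * a powr (q - 1)) (at a within {0<..})"
      by (rule has_field_derivative_at_within[OF has_real_derivative_powr[OF assms(1)]])
  qed (use assms in \<open>auto simp: interior_open\<close>)
  then show ?thesis by simp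
qed

text \<open>
  Two applications of convexity replace Taylor's formula: the tangent of \<open>x powr p\<close> at \<open>1 + u\<close>
  bounds the increment by \<open>p * u * (1 + u) powr (p - 1)\<close>, and a tangent of \<open>x powr (p - 1)\<close> then
  compares this slope with the slope at \<open>1\<close>.
\<close>

lemma powr_one_plus_le_quadratic:
  fixes u p :: real
  assumes "p \<ge> 2" "\<bar>u\<bar> < 1"
  shows "(1 + u) powr p \<le> 1 + p * u + p * (p - 1) * 2 powr (p - 2) * u\<^sup>2"
proof -
  have pos: "1 + u > 0" using assms by linarith
  have slope: "u * ((1 + u) powr (p - 1) - 1) \<le> (p - 1) * 2 powr (p - 2) * u\<^sup>2"
  proof (cases "u \<ge> 0")
    case True
    have "(1 + u) powr (p - 1) - 1 \<le> (p - 1) * (1 + u) powr (p - 2) * u"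
      using powr_tangent_le[of "1 + u" 1 "p - 1"] assms pos by (simp add: algebra_simps)
    also have "\<dots> \<le> (p - 1) * 2 powr (p - 2) * u"
      using assms True by (intro mult_right_mono mult_left_mono powr_mono2) auto
    finally have "u * ((1 + u) powr (p - 1) - 1) \<le> u * ((p - 1) * 2 powr (p - 2) * u)"
      using True by (rule mult_left_mono)
    then show ?thesis by (simp add: power2_eq_square mult_ac)
  next
    case False
    have "(1 + u) powr (p - 1) - 1 \<ge> (p - 1) * u"
      using powr_tangent_le[of 1 "1 + u" "p - 1"] assms pos by simp
    then have "u * ((1 + u) powr (p - 1) - 1) \<le> u * ((p - 1) * u)"
      using False by (intro mult_left_mono_neg) auto
    also have "\<dots> = (p - 1) * 1 * u\<^sup>2" by (simp add: power2_eq_square)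
    also have "\<dots> \<le> (p - 1) * 2 powr (p - 2) * u\<^sup>2"
      using assms by (intro mult_right_mono mult_left_mono ge_one_powr_ge_zero) auto
    finally show ?thesis .
  qed
  have "(1 + u) powr p \<le> 1 + p * u + p * (u * ((1 + u) powr (p - 1) - 1))"
    using powr_tangent_le[of "1 + u" 1 p] assms pos by (simp add: algebra_simps)
  also have "\<dots> \<le> 1 + p * u + p * ((p - 1) * 2 powr (p - 2) * u\<^sup>2)"
    using slope assms by (intro add_left_mono mult_left_mono) auto
  finally show ?thesis by (simp add: mult_ac)
qed

text \<open>
  The last summand serves the case of a small increment (\<open>powr_one_plus_le_quadratic\<close>), the first
  two the case \<open>\<bar>y\<bar> \<ge> \<bar>x\<bar>\<close>, in which \<open>\<bar>y\<bar> powr p\<close> dominates everything.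
\<close>

definition powr_taylor_const :: "real \<Rightarrow> real" where
  "powr_taylor_const p = 2 powr p + p + p * (p - 1) * 2 powr (p - 2)"

lemma powr_taylor_const_nonneg: "p \<ge> 2 \<Longrightarrow> powr_taylor_const p \<ge> 0"
  by (simp add: powr_taylor_const_def)

text \<open>
  The derivative of \<open>\<bar>x\<bar> powr p\<close> is \<open>p * sgn x * \<bar>x\<bar> powr (p - 1)\<close>, so this is a first-order
  expansion at \<open>x\<close> with a one-sided remainder. If \<open>\<bar>y\<bar> < \<bar>x\<bar>\<close>, division by \<open>\<bar>x\<bar> powr p\<close>
  reduces it to \<open>x = 1\<close>; otherwise each term is at most a multiple of \<open>\<bar>y\<bar> powr p\<close>. Keeping the
  linear term exact is the point: it is the one that centring removes.
\<close>

lemma abs_add_powr_le: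
  fixes x y p :: real
  assumes "p \<ge> 2"
  shows "\<bar>x + y\<bar> powr p \<le> \<bar>x\<bar> powr p + p * (sgn x * \<bar>x\<bar> powr (p - 1) * y)
           + powr_taylor_const p * (\<bar>x\<bar> powr (p - 2) * y\<^sup>2 + \<bar>y\<bar> powr p)"
proof (cases "\<bar>y\<bar> < \<bar>x\<bar>")
  case True
  define u where "u = y / x"
  have x: "x \<noteq> 0" and y: "y = x * u" and u: "\<bar>u\<bar> < 1"
    using True by (auto simp: u_def)
  let ?B = "p * (p - 1) * 2 powr (p - 2)"
  have "\<bar>x + y\<bar> = \<bar>x\<bar> * (1 + u)"
  proof -
    have "x + y = x * (1 + u)" by (simp add: y algebra_simps)
    then show ?thesis using u by (simp add: abs_mult)
  qed
  then have "\<bar>x + y\<bar> powr p = \<bar>x\<bar> powr p * (1 + u) powr p"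
    using u by (simp add: powr_mult)
  also have "\<dots> \<le> \<bar>x\<bar> powr p * (1 + p * u + ?B * u\<^sup>2)"
    using powr_one_plus_le_quadratic[OF assms u] by (intro mult_left_mono) auto
  also have "\<dots> = \<bar>x\<bar> powr p + p * (\<bar>x\<bar> powr p * u) + ?B * (\<bar>x\<bar> powr p * u\<^sup>2)"
    by (simp add: algebra_simps)
  also have "\<bar>x\<bar> powr p * u = sgn x * \<bar>x\<bar> powr (p - 1) * y"
  proof -
    have "\<bar>x\<bar> powr p = \<bar>x\<bar> powr (p - 1) * \<bar>x\<bar>"
      using x by (simp add: powr_diff)
    then show ?thesis by (simp add: y abs_sgn mult_ac)
  qed
  also have "\<bar>x\<bar> powr p * u\<^sup>2 = \<bar>x\<bar> powr (p - 2) * y\<^sup>2"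
  proof -
    have "\<bar>x\<bar> powr p = \<bar>x\<bar> powr (p - 2) * x\<^sup>2"
      using x by (simp add: powr_diff)
    then show ?thesis by (simp add: y power_mult_distrib mult_ac)
  qed
  also have "?B * (\<bar>x\<bar> powr (p - 2) * y\<^sup>2)
      \<le> powr_taylor_const p * (\<bar>x\<bar> powr (p - 2) * y\<^sup>2 + \<bar>y\<bar> powr p)"
    using assms by (intro mult_mono) (auto simp: powr_taylor_const_def)
  finally show ?thesis by simp
next
  case False
  have "\<bar>x + y\<bar> powr p \<le> (2 * \<bar>y\<bar>) powr p"
    using False assms by (intro powr_mono2) auto
  also have "\<dots> = 2 powr p * \<bar>y\<bar> powr p" by (simp add: powr_mult)
  finally have 1: "\<bar>x + y\<bar> powr p \<le> 2 powr p * \<bar>y\<bar> powr p" .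
  have "- (sgn x * \<bar>x\<bar> powr (p - 1) * y) \<le> \<bar>sgn x * \<bar>x\<bar> powr (p - 1) * y\<bar>" by linarith
  also have "\<dots> \<le> 1 * \<bar>y\<bar> powr (p - 1) * \<bar>y\<bar>"
    unfolding abs_mult using False assms
    by (intro mult_mono) (auto simp: sgn_if intro!: powr_mono2)
  also have "\<dots> = \<bar>y\<bar> powr p"
    by (cases "y = 0") (auto simp: powr_diff)
  finally have "p * (- (sgn x * \<bar>x\<bar> powr (p - 1) * y)) \<le> p * \<bar>y\<bar> powr p"
    using assms by (intro mult_left_mono) auto
  then have 2: "0 \<le> p * (sgn x * \<bar>x\<bar> powr (p - 1) * y) + p * \<bar>y\<bar> powr p" by simp
  have "(2 powr p + p) * \<bar>y\<bar> powr p
      \<le> powr_taylor_const p * (\<bar>x\<bar> powr (p - 2) * y\<^sup>2 + \<bar>y\<bar> powr p)"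
    using assms by (intro mult_mono) (auto simp: powr_taylor_const_def)
  with 1 2 have "\<bar>x + y\<bar> powr p \<le> p * (sgn x * \<bar>x\<bar> powr (p - 1) * y)
      + powr_taylor_const p * (\<bar>x\<bar> powr (p - 2) * y\<^sup>2 + \<bar>y\<bar> powr p)"
    by (simp add: algebra_simps)
  then show ?thesis
    by (smt (verit) powr_ge_zero)
qed

text \<open>
  Splitting at the level \<open>t\<close>, where \<open>t\<close> stays free, bounds the lower moment linearly in the
  higher one. This keeps the moment recursion below linear, whereas the inequality of Lyapunov would
  introduce a fractional power of the moment.
\<close>

lemma abs_powr_le_scaled:
  fixes x t p :: real
  assumes "p \<ge> 2" "t > 0"
  shows "\<bar>x\<bar> powr (p - 2) \<le> \<bar>x\<bar> powr p / t\<^sup>2 + t powr (p - 2)"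
proof (cases "\<bar>x\<bar> \<le> t")
  case True
  then have "\<bar>x\<bar> powr (p - 2) \<le> t powr (p - 2)"
    using assms by (intro powr_mono2) auto
  then show ?thesis by (simp add: add_increasing)
next
  case False
  then have x: "x \<noteq> 0" and "t\<^sup>2 \<le> x\<^sup>2"
    using assms by (auto simp: abs_le_square_iff[symmetric])
  have "\<bar>x\<bar> powr (p - 2) * t\<^sup>2 \<le> \<bar>x\<bar> powr (p - 2) * x\<^sup>2"
    using \<open>t\<^sup>2 \<le> x\<^sup>2\<close> by (intro mult_left_mono) auto
  also have "\<dots> = \<bar>x\<bar> powr p"
    using x by (simp add: powr_diff)
  finally have "\<bar>x\<bar> powr (p - 2) \<le> \<bar>x\<bar> powr p / t\<^sup>2"
    using assms by (simp add: field_simps)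
  then show ?thesis by (simp add: add_increasing2)
qed

section \<open>Moments of partial sums of independent centred variables\<close>

lemma (in finite_measure) integrable_abs_powr_mono:
  fixes f :: "'a \<Rightarrow> real"
  assumes [measurable]: "f \<in> borel_measurable M"
    and "integrable M (\<lambda>x. \<bar>f x\<bar> powr p)" "0 \<le> q" "q \<le> p"
  shows "integrable M (\<lambda>x. \<bar>f x\<bar> powr q)"
proof (rule Bochner_Integration.integrable_bound)
  show "integrable M (\<lambda>x. 1 + \<bar>f x\<bar> powr p)"
    using assms by auto
  have "\<bar>y\<bar> powr q \<le> 1 + \<bar>y\<bar> powr p" for y :: real
  proof (cases "\<bar>y\<bar> \<le> 1")
    case True
    then have "\<bar>y\<bar> powr q \<le> 1 powr q" using assms by (intro powr_mono2) auto
    then show ?thesis by (simp add: add_increasing2)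
  next
    case False
    then show ?thesis using assms by (smt (verit) powr_mono)
  qed
  then show "AE x in M. norm (\<bar>f x\<bar> powr q) \<le> norm (1 + \<bar>f x\<bar> powr p)"
    by (auto simp: add_nonneg_nonneg)
qed measurable

text \<open>
  The expansion of \<open>abs_add_powr_le\<close> is integrated term by term: independence factorises the mixed
  terms, and the linear one has the factor \<open>expectation Y = 0\<close>.
\<close>

lemma (in prob_space) moment_add_indep_le:
  fixes T Y :: "'a \<Rightarrow> real"
  assumes p: "p > 2" and indep: "indep_var borel T borel Y"
    and T: "integrable M (\<lambda>x. \<bar>T x\<bar> powr p)" and Y: "integrable M (\<lambda>x. \<bar>Y x\<bar> powr p)"
    and mean: "expectation Y = 0"
  shows "integrable M (\<lambda>x. \<bar>T x + Y x\<bar> powr p)" (is ?int)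
    and "expectation (\<lambda>x. \<bar>T x + Y x\<bar> powr p) \<le> expectation (\<lambda>x. \<bar>T x\<bar> powr p)
      + powr_taylor_const p * (expectation (\<lambda>x. \<bar>T x\<bar> powr (p - 2)) * expectation (\<lambda>x. (Y x)\<^sup>2)
          + expectation (\<lambda>x. \<bar>Y x\<bar> powr p))" (is ?le)
proof -
  have [measurable]: "T \<in> borel_measurable M" "Y \<in> borel_measurable M"
    using indep by (auto dest: indep_var_rv1 indep_var_rv2)
  have T1: "integrable M (\<lambda>x. sgn (T x) * \<bar>T x\<bar> powr (p - 1))"
    by (rule Bochner_Integration.integrable_bound[OF
          integrable_abs_powr_mono[OF _ T, of "p - 1"]])
      (use p in \<open>auto simp: abs_mult sgn_if\<close>)
  have T2: "integrable M (\<lambda>x. \<bar>T x\<bar> powr (p - 2))"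
    using p by (intro integrable_abs_powr_mono[OF _ T]) auto
  have "integrable M (\<lambda>x. \<bar>Y x\<bar> powr 2)"
    using p by (intro integrable_abs_powr_mono[OF _ Y]) auto
  then have Y2: "integrable M (\<lambda>x. (Y x)\<^sup>2)" by simp
  then have Y1: "integrable M Y" by (rule square_integrable_imp_integrable[rotated]) measurable
  have indep1: "indep_var borel (\<lambda>x. sgn (T x) * \<bar>T x\<bar> powr (p - 1)) borel Y"
    by (rule indep_var_compose[OF indep, of "\<lambda>x. sgn x * \<bar>x\<bar> powr (p - 1)" borel "\<lambda>x. x" borel,
          unfolded comp_def]) measurable
  have indep2: "indep_var borel (\<lambda>x. \<bar>T x\<bar> powr (p - 2)) borel (\<lambda>x. (Y x)\<^sup>2)"
    by (rule indep_var_compose[OF indep, of "\<lambda>x. \<bar>x\<bar> powr (p - 2)" borel "\<lambda>x. x\<^sup>2" borel,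
          unfolded comp_def]) measurable
  note int1 = indep_var_integrable[OF indep1 T1 Y1] and int2 = indep_var_integrable[OF indep2 T2 Y2]
  let ?R = "\<lambda>x. \<bar>T x\<bar> powr p + p * (sgn (T x) * \<bar>T x\<bar> powr (p - 1) * Y x)
           + powr_taylor_const p * (\<bar>T x\<bar> powr (p - 2) * (Y x)\<^sup>2 + \<bar>Y x\<bar> powr p)"
  have R: "integrable M ?R"
    using int1 int2 T Y by auto
  have le: "\<bar>T x + Y x\<bar> powr p \<le> ?R x" for x
    using p by (intro abs_add_powr_le) auto
  show ?int
  proof (rule Bochner_Integration.integrable_bound[OF R])
    show "AE x in M. norm (\<bar>T x + Y x\<bar> powr p) \<le> norm (?R x)"
      using le by (intro always_eventually allI)
        (metis abs_ge_self abs_of_nonneg order_trans powr_ge_zero real_norm_def)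
  qed measurable
  then have "expectation (\<lambda>x. \<bar>T x + Y x\<bar> powr p) \<le> expectation ?R"
    using R le by (intro integral_mono) auto
  also have "expectation ?R = expectation (\<lambda>x. \<bar>T x\<bar> powr p)
      + p * expectation (\<lambda>x. sgn (T x) * \<bar>T x\<bar> powr (p - 1) * Y x)
      + powr_taylor_const p * (expectation (\<lambda>x. \<bar>T x\<bar> powr (p - 2) * (Y x)\<^sup>2)
          + expectation (\<lambda>x. \<bar>Y x\<bar> powr p))"
    using int1 int2 T Y by simp
  finally show ?le
    by (simp add: indep_var_lebesgue_integral[OF indep1 T1 Y1]
        indep_var_lebesgue_integral[OF indep2 T2 Y2] mean)
qed

text \<open>
  Induction on \<open>n\<close> with \<open>moment_add_indep_le\<close>. Write \<open>r = n powr (p/2 - 1)\<close> and truncate at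
  \<open>t = s * sqrt n\<close>: the \<open>(p-2)\<close>-th moment of the partial sum is then at most
  \<open>(K / s\<^sup>2 + s powr (p-2)) * r\<close>. A large \<open>s\<close> makes the contribution of \<open>K / s\<^sup>2\<close> to the
  increment at most \<open>K/2 * r\<close>, and after that a large \<open>K\<close> absorbs the rest into a second
  \<open>K/2 * r\<close>. This fits because \<open>n powr (p/2) + r = (n + 1) * r \<le> (n + 1) powr (p/2)\<close>.
\<close>

lemma (in prob_space) moment_partial_sum_le:
  fixes Y :: "nat \<Rightarrow> 'a \<Rightarrow> real"
  assumes p: "p > 2" and indep: "indep_vars (\<lambda>_. borel) Y UNIV"
    and int: "\<And>i. integrable M (\<lambda>x. \<bar>Y i x\<bar> powr p)"
    and mean: "\<And>i. expectation (Y i) = 0"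
    and m: "\<And>i. expectation (\<lambda>x. \<bar>Y i x\<bar> powr p) \<le> m"
    and v: "\<And>i. expectation (\<lambda>x. (Y i x)\<^sup>2) \<le> v"
  shows "\<exists>K. \<forall>n. integrable M (\<lambda>x. \<bar>\<Sum>i<n. Y i x\<bar> powr p)
           \<and> expectation (\<lambda>x. \<bar>\<Sum>i<n. Y i x\<bar> powr p) \<le> K * real n powr (p / 2)"
proof -
  let ?C = "powr_taylor_const p"
  have C: "?C \<ge> 0" using p by (intro powr_taylor_const_nonneg) auto
  have m0: "m \<ge> 0" by (rule order_trans[OF _ m[of 0]]) auto
  have v0: "v \<ge> 0" by (rule order_trans[OF _ v[of 0]]) auto
  \<comment> \<open>The summand \<open>1\<close> keeps \<open>s\<close> positive when \<open>v = 0\<close>.\<close>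
  define s where "s = sqrt (2 * ?C * v + 1)"
  have s: "s > 0" and s2: "s\<^sup>2 = 2 * ?C * v + 1"
    using C v0 by (auto simp: s_def intro!: add_nonneg_pos)
  define K where "K = 2 * (?C * v * s powr (p - 2) + ?C * m)"
  have K: "K \<ge> 0" using C m0 v0 by (simp add: K_def)
  let ?T = "\<lambda>n x. \<Sum>i<n. Y i x"
  have "integrable M (\<lambda>x. \<bar>?T n x\<bar> powr p)
      \<and> expectation (\<lambda>x. \<bar>?T n x\<bar> powr p) \<le> K * real n powr (p / 2)" for n
  proof (induction n)
    case 0
    then show ?case by simp
  next
    case (Suc n)
    let ?a = "expectation (\<lambda>x. \<bar>?T n x\<bar> powr p)" and ?r = "real n powr (p / 2 - 1)"
    have "indep_var borel (Y n) borel (?T n)"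
      by (rule indep_vars_sum) (auto intro: indep_vars_subset[OF indep])
    then have iv: "indep_var borel (?T n) borel (Y n)"
      unfolding indep_var_eq indep_sets2_eq
      by (metis (no_types, lifting) Int_commute mult.commute)
    have Tm [measurable]: "?T n \<in> borel_measurable M"
      using iv by (rule indep_var_rv1)
    note step = moment_add_indep_le[OF p iv conjunct1[OF Suc.IH] int mean]
    let ?q = "expectation (\<lambda>x. \<bar>?T n x\<bar> powr (p - 2))"
    have "expectation (\<lambda>x. \<bar>?T (Suc n) x\<bar> powr p) \<le>
        ?a + ?C * (?q * expectation (\<lambda>x. (Y n x)\<^sup>2) + expectation (\<lambda>x. \<bar>Y n x\<bar> powr p))"
      using step(2) by simp
    also have "\<dots> \<le> ?a + ?C * (?q * v + m)"
      using C m v by (intro add_left_mono mult_left_mono add_mono) auto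
    also have "\<dots> \<le> K * real (Suc n) powr (p / 2)"
      \<comment> \<open>For \<open>n = 0\<close> the truncation level would be \<open>0\<close>; there the partial sum vanishes.\<close>
    proof (cases "n = 0")
      case True
      have "?C * m \<le> K" using C m0 v0 by (simp add: K_def)
      with True show ?thesis by simp
    next
      case False
      then have n: "real n \<ge> 1" by simp
      have rn: "real n powr (p / 2) = real n * ?r"
        using n by (simp add: powr_diff)
      have r1: "?r \<ge> 1"
        using n p by (intro ge_one_powr_ge_zero) auto
      define t where "t = s * sqrt (real n)"
      have t: "t > 0" and t2: "t\<^sup>2 = s\<^sup>2 * real n"
        using s n by (auto simp: t_def power_mult_distrib)
      have tr: "t powr (p - 2) = s powr (p - 2) * ?r"
        using s n by (simp add: t_def powr_mult powr_half_sqrt[symmetric] powr_powr diff_divide_distrib)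
      have "?q \<le> expectation (\<lambda>x. \<bar>?T n x\<bar> powr p / t\<^sup>2 + t powr (p - 2))"
        using p t Suc.IH
        by (intro integral_mono abs_powr_le_scaled) (auto intro!: integrable_abs_powr_mono[of _ p])
      also have "\<dots> = ?a / t\<^sup>2 + t powr (p - 2)"
        using Suc.IH by (simp add: prob_space)
      also have "\<dots> \<le> K * (real n * ?r) / t\<^sup>2 + t powr (p - 2)"
        using Suc.IH t by (intro add_right_mono divide_right_mono) (auto simp: rn)
      also have "\<dots> = (K / s\<^sup>2 + s powr (p - 2)) * ?r"
        using n by (simp add: t2 tr algebra_simps)
      finally have q: "?q \<le> (K / s\<^sup>2 + s powr (p - 2)) * ?r" .
      have half: "?C * v * (K / s\<^sup>2) \<le> K / 2"
      proof -
        have "?C * v * K \<le> K / 2 * s\<^sup>2"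
          using K by (simp add: s2 algebra_simps)
        then show ?thesis using s by (simp add: divide_simps)
      qed
      have "?C * (?q * v + m) \<le> ?C * ((K / s\<^sup>2 + s powr (p - 2)) * ?r * v + m * ?r)"
        using C v0 q m0 r1 mult_left_mono[OF r1 m0]
        by (intro mult_left_mono add_mono mult_right_mono) auto
      also have "\<dots> = (?C * v * (K / s\<^sup>2) + K / 2) * ?r"
        by (simp add: K_def algebra_simps)
      also have "\<dots> \<le> K * ?r"
        by (rule mult_right_mono) (use half in linarith, simp)
      finally have "?a + ?C * (?q * v + m) \<le> K * (real n * ?r) + K * ?r"
        using Suc.IH by (simp add: rn)
      also have "\<dots> = K * (real (Suc n) * ?r)" by (simp add: algebra_simps)
      also have "\<dots> \<le> K * (real (Suc n) * real (Suc n) powr (p / 2 - 1))"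
        using K p by (intro mult_left_mono powr_mono2) auto
      also have "real (Suc n) * real (Suc n) powr (p / 2 - 1) = real (Suc n) powr (p / 2)"
        by (simp add: powr_diff)
      finally show ?thesis .
    qed
    finally show ?case using step(1) by simp
  qed
  then show ?thesis by blast
qed

section \<open>The lower bound from the central limit theorem\<close>

lemma cdf_std_normal_pos: "cdf std_normal_distribution x > 0"
proof -
  interpret real_distribution std_normal_distribution by (rule real_dist_normal_dist)
  have "\<not> (AE y in lborel. y \<in> {..x} \<longrightarrow> False)"
  proof
    assume "AE y in lborel. y \<in> {..x} \<longrightarrow> False"
    then have "emeasure lborel {..x} = 0"
      by (subst (asm) AE_iff_measurable[of "{..x}"]) auto
    moreover have "emeasure lborel {x - 1..x} \<le> emeasure lborel {..x}"
      by (intro emeasure_mono) auto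
    ultimately show False by simp
  qed
  moreover have "emeasure std_normal_distribution {..x} = 0
      \<longleftrightarrow> (AE y in lborel. y \<in> {..x} \<longrightarrow> False)"
  proof -
    have "{..x} \<in> null_sets std_normal_distribution
      \<longleftrightarrow> (AE y in lborel. y \<in> {..x} \<longrightarrow> ennreal (std_normal_density y) = 0)"
      by (subst null_sets_density_iff) auto
    moreover have "ennreal (std_normal_density y) \<noteq> 0" for y
      using normal_density_pos[of 1 0 y] by (simp add: ennreal_eq_0_iff)
    ultimately show ?thesis by (simp add: null_sets_def)
  qed
  ultimately have "emeasure std_normal_distribution {..x} \<noteq> 0" by blast
  then show ?thesis
    by (simp add: cdf_def emeasure_eq_measure zero_less_measure_iff)
qed

lemma isCont_cdf_std_normal: "isCont (cdf std_normal_distribution) x"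
proof -
  interpret real_distribution std_normal_distribution by (rule real_dist_normal_dist)
  have "AE y in lborel. y \<in> {x} \<longrightarrow> ennreal (std_normal_density y) = 0"
    using AE_lborel_singleton[of x] by eventually_elim simp
  then have "{x} \<in> null_sets std_normal_distribution"
    by (subst null_sets_density_iff) auto
  then show ?thesis by (simp add: isCont_cdf null_sets_def measure_def)
qed

text \<open>
  The normal limit puts mass \<open>\<Phi>(-1) > 0\<close> on \<open>{..-1}\<close>, so for large \<open>n\<close> the normalised sum is at
  most \<open>-1\<close> with probability at least \<open>\<Phi>(-1)/2\<close>, and integrating over this event alone gives the
  right order. The moment is taken in \<open>[0,\<infinity>]\<close>, so the argument works for every \<open>p > 0\<close>,
  whether or not the \<open>p\<close>-th moment is finite.
\<close>

lemma (in prob_space) mean_error_eventually_ge: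
  fixes Y :: "nat \<Rightarrow> 'a \<Rightarrow> real"
  assumes p: "p > 0" and indep: "indep_vars (\<lambda>_. borel) Y UNIV"
    and mean: "\<And>i. expectation (Y i) = 0"
    and int: "\<And>i. integrable M (\<lambda>x. (Y i x)\<^sup>2)"
    and \<sigma>: "\<sigma> > 0" and var: "\<And>i. expectation (\<lambda>x. (Y i x)\<^sup>2) = \<sigma>\<^sup>2"
    and distr: "\<And>i. distr M borel (Y i) = \<nu>"
  shows "\<exists>c>0. \<forall>\<^sub>F n in sequentially. ennreal (c * real n powr (- p / 2))
           \<le> (\<integral>\<^sup>+x. ennreal (\<bar>(\<Sum>i<n. Y i x) / real n\<bar> powr p) \<partial>M)"
proof -
  have [measurable]: "Y i \<in> borel_measurable M" for i
    using indep unfolding indep_vars_def2 by auto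
  let ?Z = "\<lambda>n x. (\<Sum>i<n. Y i x) / sqrt (real n * \<sigma>\<^sup>2)"
  define \<Phi> where "\<Phi> = cdf std_normal_distribution (-1)"
  have \<Phi>: "\<Phi> > 0" unfolding \<Phi>_def by (rule cdf_std_normal_pos)
  have "weak_conv_m (\<lambda>n. distr M borel (?Z n)) std_normal_distribution"
    using mean int var distr by (intro central_limit_theorem_zero_mean[OF indep _ \<sigma>]) auto
  then have "(\<lambda>n. cdf (distr M borel (?Z n)) (-1)) \<longlonglongrightarrow> \<Phi>"
    unfolding weak_conv_m_def weak_conv_def \<Phi>_def using isCont_cdf_std_normal by blast
  then have ev: "\<forall>\<^sub>F n in sequentially. cdf (distr M borel (?Z n)) (-1) > \<Phi> / 2"
    using \<Phi> by (intro order_tendstoD(1)) auto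
  have "\<forall>\<^sub>F n in sequentially. ennreal (\<sigma> powr p * (\<Phi> / 2) * real n powr (- p / 2))
           \<le> (\<integral>\<^sup>+x. ennreal (\<bar>(\<Sum>i<n. Y i x) / real n\<bar> powr p) \<partial>M)"
    using ev eventually_gt_at_top[of 0]
  proof eventually_elim
    case (elim n)
    let ?A = "{x \<in> space M. ?Z n x \<le> -1}" and ?b = "\<sigma> powr p * real n powr (- p / 2)"
    have A: "measure M ?A \<ge> \<Phi> / 2"
      using elim by (simp add: cdf_def measure_distr vimage_def Int_def conj_commute)
    have "ennreal (\<sigma> powr p * (\<Phi> / 2) * real n powr (- p / 2)) = ennreal (?b * (\<Phi> / 2))"
      by (simp add: mult_ac)
    also have "\<dots> \<le> ennreal (?b * measure M ?A)"
      using A by (intro ennreal_leI mult_left_mono) auto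
    also have "\<dots> = (\<integral>\<^sup>+x. ennreal ?b * indicator ?A x \<partial>M)"
      by (subst nn_integral_cmult_indicator) (auto simp: ennreal_mult emeasure_eq_measure)
    also have "\<dots> \<le> (\<integral>\<^sup>+x. ennreal (\<bar>(\<Sum>i<n. Y i x) / real n\<bar> powr p) \<partial>M)"
    proof (intro nn_integral_mono)
      fix x assume "x \<in> space M"
      show "ennreal ?b * indicator ?A x \<le> ennreal (\<bar>(\<Sum>i<n. Y i x) / real n\<bar> powr p)"
      proof (cases "x \<in> ?A")
        case True
        let ?S = "\<Sum>i<n. Y i x"
        have "sqrt (real n * \<sigma>\<^sup>2) = sqrt (real n) * \<sigma>"
          using \<sigma> by (simp add: real_sqrt_mult)
        then have "?S \<le> - (sqrt (real n) * \<sigma>)"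
          using True \<sigma> elim by (simp add: divide_le_eq)
        then have "sqrt (real n) * \<sigma> / real n \<le> \<bar>?S / real n\<bar>"
          using elim by (simp add: divide_right_mono)
        also have "sqrt (real n) * \<sigma> / real n = \<sigma> * real n powr (- 1 / 2)"
          using elim by (simp add: powr_minus powr_half_sqrt field_simps)
        finally have "(\<sigma> * real n powr (- 1 / 2)) powr p \<le> \<bar>?S / real n\<bar> powr p"
          using p \<sigma> by (intro powr_mono2) auto
        then show ?thesis
          using True \<sigma> by (simp add: powr_mult powr_powr ennreal_leI)
      qed simp
    qed
    finally show ?case .
  qed
  then show ?thesis using \<Phi> \<sigma> by (intro exI[of _ "\<sigma> powr p * (\<Phi> / 2)"]) auto
qed

section \<open>Summability of the errors\<close>

lemma not_S_Lp_convergesI: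
  fixes Y :: "nat \<Rightarrow> 'a \<Rightarrow> real"
  assumes p: "0 < p" "p \<le> 2"
    and lower: "\<exists>c>0. \<forall>\<^sub>F n in sequentially. ennreal (c * real n powr (- p / 2))
           \<le> (\<integral>\<^sup>+x. ennreal (\<bar>Y n x - Z x\<bar> powr p) \<partial>M)"
  shows "\<not> S_Lp_converges M p Y Z"
proof
  assume "S_Lp_converges M p Y Z"
  let ?a = "\<lambda>n. \<integral>\<^sup>+x. ennreal (\<bar>Y n x - Z x\<bar> powr p) \<partial>M"
  have fin: "(\<Sum>n. ?a (Suc n)) < top"
    using \<open>S_Lp_converges M p Y Z\<close> by (simp add: S_Lp_converges_def)
  obtain c N where c: "c > 0" and N: "\<And>n. n \<ge> N \<Longrightarrow> ennreal (c * real n powr (- p / 2)) \<le> ?a n"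
    using lower by (auto simp: eventually_sequentially)
  let ?b = "\<lambda>n. c * real n powr (- p / 2)"
  have "(\<Sum>n. ennreal (?b (n + Suc N))) \<le> (\<Sum>n. ?a (Suc (n + N)))"
    using N[of "Suc (_ + N)"] by (intro suminf_le) (auto simp del: of_nat_Suc)
  also have "\<dots> \<le> (\<Sum>n. ?a (Suc n))"
    using suminf_offset[of "\<lambda>n. ?a (Suc n)" N] by simp
  finally have "(\<Sum>n. ennreal (?b (n + Suc N))) \<noteq> top" using fin by (auto simp: top_unique)
  then have "summable (\<lambda>n. ?b (n + Suc N))"
    using c by (intro summable_suminf_not_top) auto
  then have "summable ?b" by (subst (asm) summable_iff_shift)
  then have "summable (\<lambda>n. real n powr (- p / 2))"
    using c by (simp add: summable_cmult_iff)
  then show False using p by (simp add: summable_real_powr_iff)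
qed

lemma S_Lp_convergesI:
  fixes Y :: "nat \<Rightarrow> 'a \<Rightarrow> real"
  assumes p: "p > 2"
    and int: "\<And>n. n > 0 \<Longrightarrow> integrable M (\<lambda>x. \<bar>Y n x - Z x\<bar> powr p)"
    and upper: "\<And>n. n > 0 \<Longrightarrow>
      integral\<^sup>L M (\<lambda>x. \<bar>Y n x - Z x\<bar> powr p) \<le> K * real n powr (- p / 2)"
  shows "S_Lp_converges M p Y Z"
proof -
  let ?a = "\<lambda>n. integral\<^sup>L M (\<lambda>x. \<bar>Y (Suc n) x - Z x\<bar> powr p)"
  have "summable (\<lambda>n. K * real n powr (- p / 2))"
    using p by (intro summable_mult) (simp add: summable_real_powr_iff)
  then have "summable (\<lambda>n. K * real (Suc n) powr (- p / 2))"
    by (subst summable_Suc_iff)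
  moreover have "norm (?a n) \<le> K * real (Suc n) powr (- p / 2)" for n
    using upper[of "Suc n"] by (simp del: of_nat_Suc)
  ultimately have "summable ?a"
    by (rule summable_comparison_test'[where N = 0])
  then have "(\<Sum>n. ennreal (?a n)) < \<infinity>"
    by (subst suminf_ennreal2) auto
  then show ?thesis
    unfolding S_Lp_converges_def using int by (simp add: nn_integral_eq_integral)
qed

section \<open>Partial sums of an i.i.d. sequence\<close>

lemma (in prob_space) indep_vars_reindex:
  assumes indep: "indep_vars M' X (f ` I)" and inj: "inj_on f I"
  shows "indep_vars (\<lambda>i. M' (f i)) (\<lambda>i. X (f i)) I"
proof -
  let ?F = "\<lambda>i. {X i -` A \<inter> space M | A. A \<in> sets (M' i)}"
  have rv: "\<forall>i\<in>I. random_variable (M' (f i)) (X (f i))" and F: "indep_sets ?F (f ` I)"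
    using indep by (auto simp: indep_vars_def2)
  have "indep_sets (\<lambda>i. ?F (f i)) I"
  proof (rule indep_setsI)
    fix i assume "i \<in> I"
    then show "?F (f i) \<subseteq> events" using F unfolding indep_sets_def by blast
  next
    fix A J assume J: "J \<noteq> {}" "J \<subseteq> I" "finite J" and A: "\<forall>j\<in>J. A j \<in> ?F (f j)"
    have injJ: "inj_on f J" using inj J by (blast intro: inj_on_subset)
    let ?B = "\<lambda>k. A (the_inv_into J f k)"
    have B: "?B (f j) = A j" if "j \<in> J" for j
      using that injJ by (simp add: the_inv_into_f_f)
    have "prob (\<Inter>k\<in>f ` J. ?B k) = (\<Prod>k\<in>f ` J. prob (?B k))"
      using J A B by (intro indep_setsD[OF F]) auto
    then show "prob (\<Inter>j\<in>J. A j) = (\<Prod>j\<in>J. prob (A j))"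
      using B injJ by (simp add: prod.reindex cong: INF_cong_simp prod.cong)
  qed
  with rv show ?thesis by (auto simp: indep_vars_def2)
qed

theorem theorem2p2:
  fixes M :: "'a measure" and X :: "'a \<Rightarrow> real" and Xs :: "nat \<Rightarrow> 'a \<Rightarrow> real"
  assumes "prob_space M"
    and "X \<in> borel_measurable M"
    and "prob_space.indep_vars M (\<lambda>_. borel) Xs {1..}"
    and "\<And>n. n \<ge> 1 \<Longrightarrow> distr M borel (Xs n) = distr M borel X"
  shows "(integrable M (\<lambda>\<omega>. (X \<omega>)\<^sup>2) \<and> \<not> (AE \<omega> in M. X \<omega> = integral\<^sup>L M X) \<longrightarrow>
           (\<forall>p::real. 0 < p \<and> p \<le> 2 \<longrightarrow>
             \<not> S_Lp_converges M p (\<lambda>n \<omega>. (\<Sum>i=1..n. Xs i \<omega>) / real n) (\<lambda>_. integral\<^sup>L M X)))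
       \<and> (\<forall>\<alpha>::real. \<alpha> > 2 \<and> integrable M (\<lambda>\<omega>. \<bar>X \<omega>\<bar> powr \<alpha>) \<longrightarrow>
           (\<forall>p::real. 2 < p \<and> p \<le> \<alpha> \<longrightarrow>
             S_Lp_converges M p (\<lambda>n \<omega>. (\<Sum>i=1..n. Xs i \<omega>) / real n) (\<lambda>_. integral\<^sup>L M X)))"
proof -
  interpret prob_space M by fact
  note X [measurable] = assms(2)
  define \<mu> where "\<mu> = expectation X"
  define Y where "Y i \<omega> = Xs (Suc i) \<omega> - \<mu>" for i \<omega>
  have "range Suc = {1..}"
    by (auto simp: image_iff Suc_le_eq gr0_conv_Suc)
  then have "indep_vars (\<lambda>_. borel) (\<lambda>i. Xs (Suc i)) UNIV"
    using indep_vars_reindex[of "\<lambda>_. borel" Xs Suc UNIV] assms(3)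
    by simp
  then have indep: "indep_vars (\<lambda>_. borel) Y UNIV"
    unfolding Y_def by (rule indep_vars_compose2) simp
  then have Y [measurable]: "Y i \<in> borel_measurable M" for i
    by (auto simp: indep_vars_def2)
  have Xs [measurable]: "Xs (Suc i) \<in> borel_measurable M" for i
    using assms(3) by (auto simp: indep_vars_def2)
  have distr: "distr M borel (Y i) = distr M borel (\<lambda>\<omega>. X \<omega> - \<mu>)" for i
  proof -
    have "distr M borel (Y i) = distr (distr M borel (Xs (Suc i))) borel (\<lambda>x. x - \<mu>)"
      by (subst distr_distr) (auto simp: Y_def[abs_def] comp_def)
    also have "\<dots> = distr (distr M borel X) borel (\<lambda>x. x - \<mu>)"
      using assms(4)[of "Suc i"] by simp
    also have "\<dots> = distr M borel (\<lambda>\<omega>. X \<omega> - \<mu>)"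
      by (subst distr_distr) (auto simp: comp_def)
    finally show ?thesis .
  qed
  have transfer: "expectation (\<lambda>\<omega>. g (Y i \<omega>)) = expectation (\<lambda>\<omega>. g (X \<omega> - \<mu>))"
      "integrable M (\<lambda>\<omega>. g (Y i \<omega>)) \<longleftrightarrow> integrable M (\<lambda>\<omega>. g (X \<omega> - \<mu>))"
    if [measurable]: "g \<in> borel_measurable borel" for g :: "real \<Rightarrow> real" and i
    using integral_distr[of "Y i" M borel g] integral_distr[of "\<lambda>\<omega>. X \<omega> - \<mu>" M borel g]
      integrable_distr_eq[of "Y i" M borel g] integrable_distr_eq[of "\<lambda>\<omega>. X \<omega> - \<mu>" M borel g]
    by (simp_all add: distr)
  have mean: "expectation (Y i) = 0" if "integrable M X" for i
    using transfer(1)[of "\<lambda>x. x" i] that by (simp add: \<mu>_def prob_space)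
  let ?A = "\<lambda>n \<omega>. (\<Sum>i=1..n. Xs i \<omega>) / real n"
  have err: "?A n \<omega> - \<mu> = (\<Sum>i<n. Y i \<omega>) / real n" if "n > 0" for n \<omega>
  proof -
    have "(\<Sum>i=1..n. Xs i \<omega>) = (\<Sum>i<n. Xs (Suc i) \<omega>)"
      by (simp add: sum.atLeast1_atMost_eq)
    then show ?thesis
      using that by (simp add: Y_def sum_subtractf field_simps)
  qed
  show ?thesis
    unfolding \<mu>_def[symmetric]
  proof (intro conjI impI allI; elim conjE)
    fix p :: real
    assume X2: "integrable M (\<lambda>\<omega>. (X \<omega>)\<^sup>2)" and nonconst: "\<not> (AE \<omega> in M. X \<omega> = \<mu>)"
      and p: "0 < p" "p \<le> 2"
    have X1: "integrable M X" using X2 by (rule square_integrable_imp_integrable[OF X])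
    have D2: "integrable M (\<lambda>\<omega>. (X \<omega> - \<mu>)\<^sup>2)"
      using X1 X2 by (simp add: power2_diff)
    define \<sigma> where "\<sigma> = sqrt (variance X)"
    have "variance X \<noteq> 0"
      using nonconst D2 by (auto simp: integral_nonneg_eq_0_iff_AE \<mu>_def)
    then have "variance X > 0"
      using variance_positive[of X] by linarith
    then have \<sigma>: "\<sigma> > 0" "\<sigma>\<^sup>2 = variance X"
      by (auto simp: \<sigma>_def)
    have "\<exists>c>0. \<forall>\<^sub>F n in sequentially. ennreal (c * real n powr (- p / 2))
           \<le> (\<integral>\<^sup>+x. ennreal (\<bar>(\<Sum>i<n. Y i x) / real n\<bar> powr p) \<partial>M)"
      using mean[OF X1] D2 \<sigma> transfer[of "\<lambda>x. x\<^sup>2"] distr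
      by (intro mean_error_eventually_ge[OF p(1) indep]) (auto simp: \<mu>_def)
    then obtain c where "c > 0" and "\<forall>\<^sub>F n in sequentially. ennreal (c * real n powr (- p / 2))
           \<le> (\<integral>\<^sup>+x. ennreal (\<bar>(\<Sum>i<n. Y i x) / real n\<bar> powr p) \<partial>M)" by blast
    from this(2) have "\<forall>\<^sub>F n in sequentially. ennreal (c * real n powr (- p / 2))
           \<le> (\<integral>\<^sup>+x. ennreal (\<bar>?A n x - \<mu>\<bar> powr p) \<partial>M)"
      using eventually_gt_at_top[of 0] by eventually_elim (simp only: err)
    with \<open>c > 0\<close> show "\<not> S_Lp_converges M p ?A (\<lambda>_. \<mu>)"
      using p by (intro not_S_Lp_convergesI) auto
  next
    fix \<alpha> p :: real
    assume "\<alpha> > 2" and X\<alpha>: "integrable M (\<lambda>\<omega>. \<bar>X \<omega>\<bar> powr \<alpha>)" and p: "2 < p" "p \<le> \<alpha>"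
    have Xp: "integrable M (\<lambda>\<omega>. \<bar>X \<omega>\<bar> powr p)"
      using p by (intro integrable_abs_powr_mono[OF _ X\<alpha>]) auto
    have "integrable M (\<lambda>\<omega>. \<bar>X \<omega>\<bar> powr 1)"
      using p by (intro integrable_abs_powr_mono[OF _ Xp]) auto
    then have X1: "integrable M X" by (simp add: integrable_abs_iff)
    have "integrable M (\<lambda>\<omega>. \<bar>X \<omega> - \<mu>\<bar> powr p)"
    proof (rule Bochner_Integration.integrable_bound)
      show "integrable M (\<lambda>\<omega>. 2 powr p * (\<bar>X \<omega>\<bar> powr p + \<bar>\<mu>\<bar> powr p))"
        using Xp by simp
      have "\<bar>x - \<mu>\<bar> powr p \<le> 2 powr p * (\<bar>x\<bar> powr p + \<bar>\<mu>\<bar> powr p)" for x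
      proof -
        have "\<bar>x - \<mu>\<bar> powr p \<le> (2 * max \<bar>x\<bar> \<bar>\<mu>\<bar>) powr p"
          using p by (intro powr_mono2) auto
        also have "\<dots> \<le> 2 powr p * (\<bar>x\<bar> powr p + \<bar>\<mu>\<bar> powr p)"
          by (auto simp: powr_mult max_def)
        finally show ?thesis .
      qed
      then show "AE \<omega> in M. norm (\<bar>X \<omega> - \<mu>\<bar> powr p) \<le> norm (2 powr p * (\<bar>X \<omega>\<bar> powr p + \<bar>\<mu>\<bar> powr p))"
        by (auto simp: abs_of_nonneg)
    qed measurable
    then have Yp: "integrable M (\<lambda>\<omega>. \<bar>Y i \<omega>\<bar> powr p)" for i
      using transfer(2)[of "\<lambda>x. \<bar>x\<bar> powr p"] by simp
    obtain K where K: "\<And>n. integrable M (\<lambda>x. \<bar>\<Sum>i<n. Y i x\<bar> powr p)"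
        "\<And>n. expectation (\<lambda>x. \<bar>\<Sum>i<n. Y i x\<bar> powr p) \<le> K * real n powr (p / 2)"
      using moment_partial_sum_le[OF p(1) indep Yp mean[OF X1],
          of "expectation (\<lambda>\<omega>. \<bar>X \<omega> - \<mu>\<bar> powr p)" "expectation (\<lambda>\<omega>. (X \<omega> - \<mu>)\<^sup>2)"]
        transfer(1)[of "\<lambda>x. \<bar>x\<bar> powr p"] transfer(1)[of "\<lambda>x. x\<^sup>2"] by auto
    have errp: "\<bar>?A n \<omega> - \<mu>\<bar> powr p = \<bar>\<Sum>i<n. Y i \<omega>\<bar> powr p / real n powr p" if "n > 0" for n \<omega>
      unfolding err[OF that] by (simp add: powr_divide)
    show "S_Lp_converges M p ?A (\<lambda>_. \<mu>)"
    proof (rule S_Lp_convergesI[OF p(1)])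
      fix n :: nat assume n: "n > 0"
      show "integrable M (\<lambda>x. \<bar>?A n x - \<mu>\<bar> powr p)"
        unfolding errp[OF n] using K(1) by simp
      have "expectation (\<lambda>x. \<bar>?A n x - \<mu>\<bar> powr p)
          \<le> K * real n powr (p / 2) / real n powr p"
        unfolding errp[OF n] using K(2)[of n] by (simp add: divide_right_mono)
      also have "\<dots> = K * real n powr (p / 2 - p)"
        by (simp only: powr_diff times_divide_eq_right)
      also have "p / 2 - p = - p / 2" by simp
      finally show "expectation (\<lambda>x. \<bar>?A n x - \<mu>\<bar> powr p) \<le> K * real n powr (- p / 2)" .
    qed
  qed
qed

end
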